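(* Let $(\Omega,\mathcal{F},\{\mathcal{F}_t\}_{t\ge 0},\Pr)$ be a filtered probability space, let $(S,\Sigma)$ be a measurable space, and let $\{X_t\}_{t\in\mathbb{N}}$ with $X_t\colon\Omega\to S$ be a discrete-time stochastic process adapted to $\{\mathcal{F}_t\}$. Let $A,B\in\Sigma$. Suppose there exist a (measurable) nonnegative function $V\colon S\to\mathbb{R}_{\ge 0}$ and constants $\epsilon>0$, $M>0$ such that for every $t\in\mathbb{N}$, almost surely, $$E[V(X_{t+1})\mid\mathcal{F}_t]\le V(X_t)-\epsilon\cdot\mathbf{1}_{A\setminus B}(X_t)+M\cdot\mathbf{1}_B(X_t).$$ Then $$\Pr\left(\sum_{t=0}^\infty \mathbf{1}_A(X_t)<\infty\ \lor\ \sum_{t=0}^\infty \mathbf{1}_B(X_t)=\infty\right)=1,$$ i.e. $\{X_t\}$ satisfies the Streett pair $(A,B)$ almost surely.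
   Context: $\mathbf{1}_{\mathcal{S}}$ denotes the indicator function of a set $\mathcal{S}$. A Streett pair is a pair $(A,B)$ of measurable subsets of the state space; a trajectory $\tau_0,\tau_1,\dots$ satisfies it if it visits $A$ finitely often or visits $B$ infinitely often. A function $V$ as in the hypothesis is called a Streett supermartingale for $(A,B)$. *)

theory Defs
  imports "HOL-Probability.Probability"
begin

text \<open>
  Integrability of \<open>V (X t)\<close> is not required, so the conditional expectation is the one of
  nonnegative extended real functions (\<^const>\<open>nn_cond_exp\<close>). The comparison takes place in
  \<^typ>\<open>ereal\<close>, where subtraction is not truncated at 0 as it is in \<^typ>\<open>ennreal\<close>: the drift
  condition forces \<open>V (X t) \<ge> \<epsilon>\<close> whenever \<open>X t \<in> A - B\<close>, up to a null set.
\<close>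

definition streett_supermartingale ::
  "'w measure \<Rightarrow> (nat \<Rightarrow> 'w measure) \<Rightarrow> 's measure \<Rightarrow> (nat \<Rightarrow> 'w \<Rightarrow> 's) \<Rightarrow> 's set \<Rightarrow> 's set
    \<Rightarrow> ('s \<Rightarrow> real) \<Rightarrow> bool"
where
  "streett_supermartingale P F S X A B V \<longleftrightarrow>
     V \<in> borel_measurable S \<and> (\<forall>x\<in>space S. 0 \<le> V x) \<and>
     (\<exists>\<epsilon>>0. \<exists>M>0. \<forall>t. AE \<omega> in P.
        enn2ereal (nn_cond_exp P (F t) (\<lambda>\<omega>'. ennreal (V (X (t + 1) \<omega>'))) \<omega>)
          \<le> ereal (V (X t \<omega>) - \<epsilon> * indicator (A - B) (X t \<omega>) + M * indicator B (X t \<omega>)))"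

end

theory Submission
  imports Defs
begin

text \<open>
  Fix a time \<open>k\<close> and a level \<open>N\<close>, and kill the process once it visits \<open>B\<close> at a time \<open>\<ge> k\<close>.
  On the event that \<open>V (X k) \<le> N\<close>, the values of \<open>V\<close>, replaced by 0 after killing, form a
  nonnegative supermartingale of finite initial expectation that loses \<open>\<epsilon>\<close> in mean at each visit
  to \<open>A\<close> before killing, so the expected number of such visits is at most \<open>N / \<epsilon>\<close>.
  A trajectory that visits \<open>B\<close> finitely often is never killed for a suitable choice of the two
  natural numbers \<open>k\<close> and \<open>N\<close>, and there are countably many choices.
\<close>

text \<open>Telescoping. Keeping \<open>a n\<close> on the left, as
  \<open>a n + (\<Sum>i<n. b i) \<le> a 0\<close>, avoids subtraction in \<open>ennreal\<close>, so
  the bound also holds for infinite values.\<close>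

lemma suminf_le_of_drift:
  fixes a b :: "nat \<Rightarrow> ennreal"
  assumes "\<And>n. a (Suc n) + b n \<le> a n"
  shows "(\<Sum>n. b n) \<le> a 0"
proof -
  have "a n + (\<Sum>i<n. b i) \<le> a 0" for n
  proof (induction n)
    case (Suc n)
    have "a (Suc n) + (\<Sum>i<Suc n. b i) = (a (Suc n) + b n) + (\<Sum>i<n. b i)"
      by (simp add: ac_simps)
    also have "\<dots> \<le> a n + (\<Sum>i<n. b i)"
      using assms by (rule add_right_mono)
    also have "\<dots> \<le> a 0"
      by (rule Suc.IH)
    finally show ?case .
  qed simp
  then have "(\<Sum>i<n. b i) \<le> a 0" for n
    by (rule order_trans[rotated, of "a n + (\<Sum>i<n. b i)"]) simp
  then show ?thesis
    by (intro suminf_le_const summableI)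
qed

text \<open>As \<open>E\<close> belongs to the subalgebra, \<open>f\<close> and its conditional
  expectation have the same integral over \<open>E\<close>; hence the drift inequality is only
  needed on \<open>E\<close>. The additive form requires no integrability.\<close>

lemma (in sigma_finite_subalgebra) nn_cond_exp_drift:
  assumes E: "E \<in> sets F"
    and [measurable]: "f \<in> borel_measurable M" "g \<in> borel_measurable M" "h \<in> borel_measurable M"
    and drift: "AE x in M. x \<in> E \<longrightarrow> nn_cond_exp M F f x + g x \<le> h x"
  shows "(\<integral>\<^sup>+x\<in>E. f x \<partial>M) + (\<integral>\<^sup>+x\<in>E. g x \<partial>M) \<le> (\<integral>\<^sup>+x\<in>E. h x \<partial>M)"
proof -
  have [measurable]: "E \<in> sets M"
    using E subalg by (auto simp: subalgebra_def)
  have "(\<integral>\<^sup>+x\<in>E. f x \<partial>M) = (\<integral>\<^sup>+x\<in>E. nn_cond_exp M F f x \<partial>M)"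
    using nn_cond_exp_intg[of "indicator E" f] E by (simp add: mult.commute)
  then have "(\<integral>\<^sup>+x\<in>E. f x \<partial>M) + (\<integral>\<^sup>+x\<in>E. g x \<partial>M) = (\<integral>\<^sup>+x\<in>E. (nn_cond_exp M F f x + g x) \<partial>M)"
    by (simp add: nn_set_integral_add)
  also have "\<dots> \<le> (\<integral>\<^sup>+x\<in>E. h x \<partial>M)"
    using drift by (intro nn_integral_mono_AE) (auto elim!: eventually_mono split: split_indicator)
  finally show ?thesis .
qed

text \<open>Carries the drift condition from \<open>ereal\<close> to \<open>ennreal\<close>: since
  \<open>c\<close> is nonnegative, so is \<open>v - e\<close>, and nothing is truncated.\<close>

lemma add_ennreal_le_of_ereal_le_diff:
  assumes "enn2ereal c \<le> ereal (v - e)" "0 \<le> e"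
  shows "c + ennreal e \<le> ennreal v"
proof -
  have "0 \<le> v - e"
    using order_trans[OF enn2ereal_nonneg assms(1)] by simp
  moreover from this have "c \<le> ennreal (v - e)"
    using assms(1) by (simp add: ennreal.rep_eq less_eq_ennreal.rep_eq)
  ultimately have "c + ennreal e \<le> ennreal (v - e) + ennreal e"
    by (intro add_right_mono)
  with \<open>0 \<le> v - e\<close> assms(2) show ?thesis
    by (simp flip: ennreal_plus)
qed

text \<open>The terms of a convergent series tend to 0, and an indicator below 1 is 0.\<close>

lemma ennreal_suminf_indicator_finite:
  assumes "(\<Sum>t. indicator B (x t) :: ennreal) \<noteq> \<infinity>"
  obtains k where "\<And>t. k \<le> t \<Longrightarrow> x t \<notin> B"
proof -
  have "summable (\<lambda>t. indicator B (x t) :: real)"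
    using assms by (intro summable_suminf_not_top) (auto simp: ennreal_indicator)
  then have "eventually (\<lambda>t. (indicator B (x t) :: real) < 1) sequentially"
    by (intro order_tendstoD(2)[OF summable_LIMSEQ_zero]) auto
  then obtain k where "\<And>t. k \<le> t \<Longrightarrow> (indicator B (x t) :: real) < 1"
    by (auto simp: eventually_sequentially)
  then have "x t \<notin> B" if "k \<le> t" for t
    using that by (force split: split_indicator)
  then show ?thesis
    by (rule that)
qed

lemma AE_finite_visits_before_killing:
  fixes V :: "'s \<Rightarrow> real" and k N :: nat
  assumes "prob_space P"
    and "filtration (space P) F"
    and sub: "\<And>t. subalgebra P (F t)"
    and X: "\<And>t. X t \<in> measurable (F t) S"
    and [measurable]: "A \<in> sets S" "B \<in> sets S" "V \<in> borel_measurable S"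
    and "0 < \<epsilon>"
    and drift: "\<And>t. AE \<omega> in P.
      enn2ereal (nn_cond_exp P (F t) (\<lambda>\<omega>'. ennreal (V (X (t + 1) \<omega>'))) \<omega>)
        \<le> ereal (V (X t \<omega>) - \<epsilon> * indicator (A - B) (X t \<omega>) + M * indicator B (X t \<omega>))"
  shows "AE \<omega> in P. V (X k \<omega>) \<le> real N \<longrightarrow> (\<forall>i\<ge>k. X i \<omega> \<notin> B) \<longrightarrow>
    (\<Sum>n. indicator A (X (k + n) \<omega>) :: ennreal) < \<infinity>"
proof -
  interpret prob_space P by fact
  interpret filtration "space P" F by fact
  \<comment> \<open>The event of starting below level \<open>N\<close> and surviving the times
    before \<open>k + n\<close>. The range is half-open, so \<open>E 0\<close> only bounds the
    start, while \<open>E (Suc n)\<close> looks at times up to \<open>k + n\<close> and is therefore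
    known at time \<open>k + n\<close>.\<close>
  define E where "E n = {\<omega> \<in> space P. V (X k \<omega>) \<le> real N \<and> (\<forall>i\<in>{k..<k + n}. X i \<omega> \<notin> B)}" for n
  have XF: "X i \<in> measurable (F t) S" if "i \<le> t" for i t
    using X[of i] sets_F_mono[OF that] space_F by (auto simp: measurable_def)
  have XP [measurable]: "X i \<in> measurable P S" for i
    using measurable_from_subalg[OF sub X] .
  have E: "E (Suc n) \<in> sets (F (k + n))" for n
  proof -
    have [measurable]: "X k \<in> measurable (F (k + n)) S"
      by (rule XF) simp
    have "{\<omega> \<in> space (F (k + n)). X i \<omega> \<notin> B} \<in> sets (F (k + n))" if "i \<in> {k..<k + Suc n}" for i
    proof -
      have [measurable]: "X i \<in> measurable (F (k + n)) S"
        using that by (intro XF) auto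
      show ?thesis by measurable
    qed
    then have "{\<omega> \<in> space (F (k + n)). V (X k \<omega>) \<le> real N \<and> (\<forall>i\<in>{k..<k + Suc n}. X i \<omega> \<notin> B)}
        \<in> sets (F (k + n))"
      by (intro sets.sets_Collect_conj sets.sets_Collect_finite_All') auto
    then show ?thesis
      by (simp add: E_def space_F)
  qed
  have [measurable]: "E n \<in> sets P" for n
    unfolding E_def by measurable
  \<comment> \<open>The index of \<open>E\<close> differs on purpose: a visit at time
    \<open>k + n\<close> counts in \<open>b n\<close> only if the process also survives that time,
    since the drift is a decrease only off \<open>B\<close>. Thus \<open>a (Suc n)\<close> and
    \<open>b n\<close> are integrals over the same event \<open>E (Suc n)\<close>.\<close>
  define a where "a n = (\<integral>\<^sup>+\<omega>\<in>E n. ennreal (V (X (k + n) \<omega>)) \<partial>P)" for n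
  define b where "b n = (\<integral>\<^sup>+\<omega>\<in>E (Suc n). ennreal (\<epsilon> * indicator A (X (k + n) \<omega>)) \<partial>P)" for n
  have step: "a (Suc n) + b n \<le> a n" for n
  proof -
    interpret finite_measure_subalgebra P "F (k + n)"
      by unfold_locales (rule sub)
    have "a (Suc n) + b n \<le> (\<integral>\<^sup>+\<omega>\<in>E (Suc n). ennreal (V (X (k + n) \<omega>)) \<partial>P)"
      unfolding a_def b_def
    proof (intro nn_cond_exp_drift[OF E])
      show "AE \<omega> in P. \<omega> \<in> E (Suc n) \<longrightarrow>
          nn_cond_exp P (F (k + n)) (\<lambda>\<omega>. ennreal (V (X (k + Suc n) \<omega>))) \<omega>
            + ennreal (\<epsilon> * indicator A (X (k + n) \<omega>)) \<le> ennreal (V (X (k + n) \<omega>))"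
        using drift[of "k + n"]
      proof eventually_elim
        case (elim \<omega>)
        show ?case
        proof
          assume "\<omega> \<in> E (Suc n)"
          then have "X (k + n) \<omega> \<notin> B"
            by (auto simp: E_def)
          \<comment> \<open>Off \<open>B\<close> the term with \<open>M\<close> vanishes and
            \<open>A - B\<close> has the same indicator as \<open>A\<close>.\<close>
          with elim show "nn_cond_exp P (F (k + n)) (\<lambda>\<omega>. ennreal (V (X (k + Suc n) \<omega>))) \<omega>
              + ennreal (\<epsilon> * indicator A (X (k + n) \<omega>)) \<le> ennreal (V (X (k + n) \<omega>))"
            using \<open>0 < \<epsilon>\<close>
            by (intro add_ennreal_le_of_ereal_le_diff) (auto simp: indicator_def)
        qed
      qed
    qed measurable
    \<comment> \<open>Killing at time \<open>k + n\<close> only loses mass: \<open>E (Suc n)\<close>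
      is contained in \<open>E n\<close>.\<close>
    also have "\<dots> \<le> a n"
      unfolding a_def
      by (intro nn_integral_mono mult_left_mono) (auto simp: E_def split: split_indicator)
    finally show ?thesis .
  qed
  have "(\<integral>\<^sup>+\<omega>. (\<Sum>n. ennreal (\<epsilon> * indicator A (X (k + n) \<omega>)) * indicator (E (Suc n)) \<omega>) \<partial>P) = (\<Sum>n. b n)"
    unfolding b_def by (intro nn_integral_suminf) measurable
  also have "\<dots> \<le> a 0"
    using step by (rule suminf_le_of_drift)
  \<comment> \<open>The level \<open>N\<close> enters here: it makes the initial expectation finite
    even if \<open>V (X k)\<close> is not integrable.\<close>
  also have "a 0 \<le> (\<integral>\<^sup>+\<omega>. ennreal (real N) \<partial>P)"
    unfolding a_def
    by (intro nn_integral_mono) (auto simp: E_def intro!: ennreal_leI split: split_indicator)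
  also have "\<dots> < \<infinity>"
    by (simp add: emeasure_space_1 ennreal_less_top)
  finally have "AE \<omega> in P. (\<Sum>n. ennreal (\<epsilon> * indicator A (X (k + n) \<omega>)) * indicator (E (Suc n)) \<omega>) \<noteq> \<infinity>"
    by (intro nn_integral_PInf_AE) auto
  then show ?thesis
    using AE_space
  proof (eventually_elim, intro impI)
    fix \<omega>
    assume fin: "(\<Sum>n. ennreal (\<epsilon> * indicator A (X (k + n) \<omega>)) * indicator (E (Suc n)) \<omega>) \<noteq> \<infinity>"
      and "\<omega> \<in> space P" "V (X k \<omega>) \<le> real N" "\<forall>i\<ge>k. X i \<omega> \<notin> B"
    \<comment> \<open>On a trajectory that is never killed all indicators of
      \<open>E (Suc n)\<close> equal 1, so the finite sum is \<epsilon> times the number of visits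
      to \<open>A\<close> from time \<open>k\<close> on.\<close>
    then have "\<omega> \<in> E (Suc n)" for n
      by (auto simp: E_def)
    with fin \<open>0 < \<epsilon>\<close> have "ennreal \<epsilon> * (\<Sum>n. indicator A (X (k + n) \<omega>)) \<noteq> \<infinity>"
      by (simp add: ennreal_mult ennreal_indicator)
    with \<open>0 < \<epsilon>\<close> show "(\<Sum>n. indicator A (X (k + n) \<omega>) :: ennreal) < \<infinity>"
      by (auto simp: ennreal_mult_eq_top_iff less_top)
  qed
qed

theorem theorem2:
  fixes P :: "'w measure" and F :: "nat \<Rightarrow> 'w measure" and S :: "'s measure"
    and X :: "nat \<Rightarrow> 'w \<Rightarrow> 's" and A B :: "'s set"
  assumes "prob_space P"
    and "filtration (space P) F"
    and "\<And>t. subalgebra P (F t)"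
    and "\<And>t. X t \<in> measurable (F t) S"
    and "A \<in> sets S" and "B \<in> sets S"
    and "\<exists>V. streett_supermartingale P F S X A B V"
  shows "measure P {\<omega> \<in> space P.
           (\<Sum>t. indicator A (X t \<omega>) :: ennreal) < \<infinity> \<or>
           (\<Sum>t. indicator B (X t \<omega>) :: ennreal) = \<infinity>} = 1"
proof -
  interpret prob_space P by fact
  have [measurable]: "X i \<in> measurable P S" for i
    using measurable_from_subalg[OF assms(3,4)] .
  note [measurable] = assms(5,6)
  from assms(7) obtain V \<epsilon> M where V: "V \<in> borel_measurable S" "0 < \<epsilon>"
    and drift: "\<And>t. AE \<omega> in P.
      enn2ereal (nn_cond_exp P (F t) (\<lambda>\<omega>'. ennreal (V (X (t + 1) \<omega>'))) \<omega>)
        \<le> ereal (V (X t \<omega>) - \<epsilon> * indicator (A - B) (X t \<omega>) + M * indicator B (X t \<omega>))"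
    unfolding streett_supermartingale_def by blast
  have "AE \<omega> in P. \<forall>k N. V (X k \<omega>) \<le> real N \<longrightarrow> (\<forall>i\<ge>k. X i \<omega> \<notin> B) \<longrightarrow>
      (\<Sum>n. indicator A (X (k + n) \<omega>) :: ennreal) < \<infinity>"
    unfolding AE_all_countable
    by (intro allI AE_finite_visits_before_killing[OF assms(1-6) V drift])
  then have "AE \<omega> in P. (\<Sum>t. indicator A (X t \<omega>) :: ennreal) < \<infinity> \<or>
      (\<Sum>t. indicator B (X t \<omega>) :: ennreal) = \<infinity>"
  proof eventually_elim
    case (elim \<omega>)
    show ?case
    proof (intro disjCI)
      assume "(\<Sum>t. indicator B (X t \<omega>) :: ennreal) \<noteq> \<infinity>"
      then obtain k where "\<And>i. k \<le> i \<Longrightarrow> X i \<omega> \<notin> B"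
        by (rule ennreal_suminf_indicator_finite) blast
      moreover obtain N :: nat where "V (X k \<omega>) \<le> real N"
        using real_arch_simple by blast
      ultimately have "(\<Sum>n. indicator A (X (n + k) \<omega>) :: ennreal) < \<infinity>"
        using elim by (subst add.commute) blast
      \<comment> \<open>The visits before time \<open>k\<close>, at most \<open>k\<close> of them,
        do not affect finiteness.\<close>
      moreover have "(\<Sum>n<k. indicator A (X n \<omega>) :: ennreal) < \<infinity>"
        by (simp add: less_top indicator_def of_nat_less_top)
      moreover have "(\<Sum>n. indicator A (X n \<omega>) :: ennreal)
          = (\<Sum>n. indicator A (X (n + k) \<omega>)) + (\<Sum>n<k. indicator A (X n \<omega>))"
        by (rule suminf_offset) simp
      ultimately show "(\<Sum>t. indicator A (X t \<omega>) :: ennreal) < \<infinity>"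
        by simp
    qed
  qed
  then show ?thesis
    by (subst prob_Collect_eq_1) measurable
qed

end
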